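(* Let $S$ be an infinite countable subset of $]0,+\infty[$ such that the reverse linear ordering $>$ on $\mathbb{R}$ induces a well-ordering on $S$. Then given any map $f:\mathbf{B}_S\to\omega$, there is an isometric copy $X$ of $\mathbf{B}_S$ inside $\mathbf{B}_S$ such that $f$ is continuous or injective on $X$.
   Context: $\mathbf{B}_S$ is the ultrametric space of all finitely supported elements of $\mathbb{Q}^S$ with distance $d(x,y)=\max\{s\in S:x(s)\neq y(s)\}$ for $x\neq y$. That $>$ induces a well-ordering on $S$ means that every nonempty subset of $S$ has a largest element. $\omega$ is the discrete set of natural numbers. *)

theory Defs
  imports "HOL-Analysis.Analysis"
begin

text \<open>An element of \<open>\<rat>\<^sup>S\<close> is encoded as a function on all reals that vanishes outside \<open>S\<close>,
  so that equality of such functions is equality on \<open>S\<close>.\<close>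

definition B_space :: "real set \<Rightarrow> (real \<Rightarrow> rat) set" where
  "B_space S = {x. finite {s \<in> S. x s \<noteq> 0} \<and> (\<forall>s. s \<notin> S \<longrightarrow> x s = 0)}"

text \<open>The value \<open>0\<close> off the carrier is junk; the locale \<^locale>\<open>Metric_space\<close> demands symmetry and
  nonnegativity on the whole type.\<close>

definition B_dist :: "real set \<Rightarrow> (real \<Rightarrow> rat) \<Rightarrow> (real \<Rightarrow> rat) \<Rightarrow> real" where
  "B_dist S x y =
     (if x \<in> B_space S \<and> y \<in> B_space S \<and> x \<noteq> y then Max {s \<in> S. x s \<noteq> y s} else 0)"

definition isometric_copy_within ::
  "'b set \<Rightarrow> 'a set \<Rightarrow> ('a \<Rightarrow> 'a \<Rightarrow> real) \<Rightarrow> 'b set \<Rightarrow> ('b \<Rightarrow> 'b \<Rightarrow> real) \<Rightarrow> bool" where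
  "isometric_copy_within X M d N e \<longleftrightarrow>
     X \<subseteq> N \<and> (\<exists>\<phi>. bij_betw \<phi> M X \<and> (\<forall>x\<in>M. \<forall>y\<in>M. e (\<phi> x) (\<phi> y) = d x y))"

lemma B_space_finite_diff:
  assumes "x \<in> B_space S" "y \<in> B_space S"
  shows "finite {s \<in> S. x s \<noteq> y s}"
proof (rule finite_subset)
  show "{s \<in> S. x s \<noteq> y s} \<subseteq> {s \<in> S. x s \<noteq> 0} \<union> {s \<in> S. y s \<noteq> 0}" by auto
  show "finite ({s \<in> S. x s \<noteq> 0} \<union> {s \<in> S. y s \<noteq> 0})"
    using assms by (simp add: B_space_def)
qed

lemma B_dist_in:
  assumes "x \<in> B_space S" "y \<in> B_space S" "x \<noteq> y"
  shows "B_dist S x y \<in> {s \<in> S. x s \<noteq> y s}"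
proof -
  obtain s where "x s \<noteq> y s" using assms(3) by blast
  moreover from this have "s \<in> S"
    using assms(1,2) unfolding B_space_def by (cases "s \<in> S") simp_all
  ultimately have "{s \<in> S. x s \<noteq> y s} \<noteq> {}" by blast
  then have "Max {s \<in> S. x s \<noteq> y s} \<in> {s \<in> S. x s \<noteq> y s}"
    using Max_in[OF B_space_finite_diff[OF assms(1,2)]] by blast
  then show ?thesis using assms by (simp add: B_dist_def)
qed

lemma B_dist_ge:
  assumes "x \<in> B_space S" "y \<in> B_space S" "s \<in> S" "x s \<noteq> y s"
  shows "s \<le> B_dist S x y"
  using Max_ge[OF B_space_finite_diff[OF assms(1,2)], of s] assms by (auto simp: B_dist_def)

lemma B_dist_commute: "B_dist S x y = B_dist S y x"
proof -
  have "{s \<in> S. x s \<noteq> y s} = {s \<in> S. y s \<noteq> x s}" by auto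
  then show ?thesis by (auto simp: B_dist_def)
qed

lemma B_dist_pos:
  assumes "S \<subseteq> {0<..}" "x \<in> B_space S" "y \<in> B_space S" "x \<noteq> y"
  shows "0 < B_dist S x y"
  using B_dist_in[OF assms(2-4)] assms(1) by auto

lemma B_dist_nonneg:
  assumes "S \<subseteq> {0<..}"
  shows "0 \<le> B_dist S x y"
proof (cases "x \<in> B_space S \<and> y \<in> B_space S \<and> x \<noteq> y")
  case True
  then show ?thesis using B_dist_pos[OF assms] by (simp add: less_imp_le)
next
  case False
  then have "B_dist S x y = 0" unfolding B_dist_def by (rule if_not_P)
  then show ?thesis by simp
qed

lemma B_dist_ultrametric:
  assumes "S \<subseteq> {0<..}" "x \<in> B_space S" "y \<in> B_space S" "z \<in> B_space S"
  shows "B_dist S x z \<le> max (B_dist S x y) (B_dist S y z)"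
proof (cases "x = z")
  case True
  then show ?thesis
    using B_dist_nonneg[OF assms(1), of x y] by (simp add: B_dist_def)
next
  case False
  let ?s = "B_dist S x z"
  have s: "?s \<in> S" "x ?s \<noteq> z ?s" using B_dist_in[OF assms(2,4) False] by auto
  show ?thesis
  proof (cases "x ?s = y ?s")
    case True
    then show ?thesis using B_dist_ge[OF assms(3,4) s(1)] s(2) by simp
  next
    case False
    then show ?thesis using B_dist_ge[OF assms(2,3) s(1)] by simp
  qed
qed

lemma Metric_space_B:
  assumes "S \<subseteq> {0<..}"
  shows "Metric_space (B_space S) (B_dist S)"
proof
  show "0 \<le> B_dist S x y" for x y by (rule B_dist_nonneg[OF assms])
  show "B_dist S x y = B_dist S y x" for x y by (rule B_dist_commute)
  show "B_dist S x y = 0 \<longleftrightarrow> x = y" if "x \<in> B_space S" "y \<in> B_space S" for x y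
    using B_dist_pos[OF assms that] by (cases "x = y") (simp_all add: B_dist_def[of S y y])
  show "B_dist S x z \<le> B_dist S x y + B_dist S y z"
    if "x \<in> B_space S" "y \<in> B_space S" "z \<in> B_space S" for x y z
    using B_dist_ultrametric[OF assms that] B_dist_nonneg[OF assms, of x y]
      B_dist_nonneg[OF assms, of y z] by linarith
qed

end

theory Submission
  imports Defs
begin

text \<open>
  Because \<open>x(s) \<in> \<rat>\<close> can take infinitely many values, every closed ball of radius \<open>s \<in> S\<close> splits
  into infinitely many children, one for each value of the coordinate \<open>s\<close>. Conversely, let \<open>Y\<close> be a
  nonempty set such that at each of its points and at each scale \<open>s \<in> S\<close> infinitely many
  children meet \<open>Y\<close>. A countable ultrametric space with distances in \<open>S\<close> can be copied
  into such a \<open>Y\<close> point by point, since the next point only has to enter a child that is not yet used. If even infinitely many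
  \<^emph>\<open>values of a map \<open>g\<close>\<close> remain available, in the sense that no finite set of children and finite set of
  values together cover \<open>Y\<close> near the point, then the copy can be chosen with \<open>g\<close> injective on it. Call \<open>Y\<close>
  spread for \<open>g\<close> (\<open>spread\<close>); with \<open>g = id\<close> this is the plain condition on children. Spreadness up
  to a radius \<open>r\<close> only looks at scales \<open>\<le> r\<close>.

  If there is a nonempty set that is spread for \<open>f\<close> at all scales, \<open>f\<close> is injective on a copy
  (\<open>isometric_copy_in_spread\<close>). Suppose that there is none, and discard all points whose ball of
  some radius \<open>r \<in> S\<close> meets a set that is spread for \<open>f\<close> up to \<open>r\<close>. The remaining
  set \<open>R\<close> is nonempty and plainly spread: otherwise infinitely many children of some ball would be
  exhausted by smaller balls that carry pieces spread for \<open>f\<close>, and these pieces could be glued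
  (\<open>glue_spread\<close>) into a set spread for \<open>f\<close> that meets this ball.

  Now no nonempty plainly spread subset of \<open>R\<close> is spread for \<open>f\<close>, so inside it, near some
  point, finitely many children and finitely many values cover everything. The part outside
  those children is plainly spread and carries finitely many colours, and such a set has a
  monochromatic subset that is plainly spread up to some radius (\<open>constant_spread_subset\<close>). Thus
  monochromatic pieces are dense in \<open>R\<close>, and gluing them gives a plainly spread set on which \<open>f\<close> is
  locally constant. A copy inside it is one on which \<open>f\<close> is continuous.

  The well-ordering by \<open>>\<close> makes gluing possible: it provides for every point a largest ball that carries a
  piece, and the largest balls are pairwise disjoint or equal.
\<close>

section \<open>Balls\<close>

text \<open>The closed ball of radius \<open>t\<close> for \<open>t \<ge> 0\<close> (lemma \<open>zball_iff_dist\<close>). Describing it by agreement of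
  coordinates makes the ultrametric facts immediate: a ball has each of its points as a centre, and its
  children are told apart by the value at \<open>t\<close>.\<close>

definition zball :: "real set \<Rightarrow> (real \<Rightarrow> rat) \<Rightarrow> real \<Rightarrow> (real \<Rightarrow> rat) set" where
  "zball S x t = {y \<in> B_space S. \<forall>s>t. y s = x s}"

lemma zballI: "y \<in> B_space S \<Longrightarrow> (\<And>s. t < s \<Longrightarrow> y s = x s) \<Longrightarrow> y \<in> zball S x t"
  by (simp add: zball_def)

lemma zball_self: "x \<in> B_space S \<Longrightarrow> x \<in> zball S x t"
  by (simp add: zball_def)

lemma zball_space: "y \<in> zball S x t \<Longrightarrow> y \<in> B_space S"
  by (simp add: zball_def)

lemma zball_agree: "y \<in> zball S x t \<Longrightarrow> t < s \<Longrightarrow> y s = x s"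
  by (simp add: zball_def)

lemma zball_eq: "y \<in> zball S x t \<Longrightarrow> t \<le> r \<Longrightarrow> zball S y r = zball S x r"
  by (auto simp: zball_def)

lemma zball_mono: "t \<le> r \<Longrightarrow> zball S x t \<subseteq> zball S x r"
  by (auto simp: zball_def)

lemma zball_iff_dist:
  assumes "x \<in> B_space S" "y \<in> B_space S" "0 \<le> t"
  shows "y \<in> zball S x t \<longleftrightarrow> B_dist S x y \<le> t"
proof
  assume y: "y \<in> zball S x t"
  show "B_dist S x y \<le> t"
  proof (cases "x = y")
    case True
    then show ?thesis using assms(3) by (simp add: B_dist_def)
  next
    case False
    then show ?thesis
      using B_dist_in[OF assms(1,2) False] zball_agree[OF y, of "B_dist S x y"] by force
  qed
next
  assume d: "B_dist S x y \<le> t"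
  show "y \<in> zball S x t"
  proof (rule zballI[OF assms(2)])
    fix s assume "t < s"
    then show "y s = x s"
      using B_dist_ge[OF assms(1,2), of s] d assms(1,2) by (cases "s \<in> S") (force simp: B_space_def)+
  qed
qed

lemma B_dist_eqI:
  assumes "S \<subseteq> {0<..}" "x \<in> B_space S" "y \<in> zball S x t" "t \<in> S" "x t \<noteq> y t"
  shows "B_dist S x y = t"
proof (rule antisym)
  show "B_dist S x y \<le> t"
    using zball_iff_dist[OF assms(2) zball_space[OF assms(3)], of t] assms(1,3,4) by force
  show "t \<le> B_dist S x y"
    using B_dist_ge[OF assms(2) zball_space[OF assms(3)] assms(4,5)] .
qed

lemma B_dist_isosceles:
  assumes S: "S \<subseteq> {0<..}"
    and "x \<in> B_space S" "y \<in> B_space S" "z \<in> B_space S"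
    and "B_dist S y z < B_dist S x y"
  shows "B_dist S x z = B_dist S x y"
  using B_dist_ultrametric[OF S, of x y z] B_dist_ultrametric[OF S, of x z y] assms
    B_dist_commute[of S y z] by (auto simp: max_def split: if_splits)

section \<open>Spread sets\<close>

text \<open>Avoiding a finite set \<open>F\<close> of children and a finite set \<open>N\<close> of values simultaneously says that no
  finite vertex cover exists for the bipartite graph between children and values; by Koenig's theorem this
  is the same as an infinite matching, that is, infinitely many points at pairwise distance \<open>t\<close> with
  pairwise distinct values under \<open>g\<close>. The cover form is what extending a finite partial isometry uses.\<close>

definition spread ::
  "real set \<Rightarrow> ((real \<Rightarrow> rat) \<Rightarrow> 'b) \<Rightarrow> real \<Rightarrow> (real \<Rightarrow> rat) set \<Rightarrow> bool" where
  "spread S g s Y \<longleftrightarrow> Y \<subseteq> B_space S \<and>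
     (\<forall>x\<in>Y. \<forall>t\<in>S. t \<le> s \<longrightarrow>
       (\<forall>F N. finite F \<longrightarrow> finite N \<longrightarrow> (\<exists>y\<in>Y \<inter> zball S x t. y t \<notin> F \<and> g y \<notin> N)))"

lemma spread_space: "spread S g s Y \<Longrightarrow> Y \<subseteq> B_space S"
  by (simp add: spread_def)

lemma spreadE:
  assumes "spread S g s Y" "x \<in> Y" "t \<in> S" "t \<le> s" "finite F" "finite N"
  obtains y where "y \<in> Y" "y \<in> zball S x t" "y t \<notin> F" "g y \<notin> N"
  using assms unfolding spread_def by blast

text \<open>Only the coordinate \<open>t\<close> is constrained by \<open>F\<close>. At a scale below \<open>t\<close> the coordinate \<open>t\<close> does not
  change, and at scale \<open>t\<close> itself the set \<open>F\<close> is added to the children to be avoided.\<close>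

lemma spread_cut:
  fixes g :: "(real \<Rightarrow> rat) \<Rightarrow> 'b"
  assumes Y: "spread S g s Y" and "t \<le> s" "finite F"
  shows "spread S g t {y \<in> Y \<inter> zball S x t. y t \<notin> F}" (is "spread S g t ?C")
  unfolding spread_def
proof (intro conjI ballI allI impI)
  show "?C \<subseteq> B_space S" using spread_space[OF Y] by blast
next
  fix z t' and F' :: "rat set" and N :: "'b set"
  assume z: "z \<in> ?C" and t': "t' \<in> S" "t' \<le> t" and fin: "finite F'" "finite N"
  obtain y where y: "y \<in> Y" "y \<in> zball S z t'" "y t' \<notin> F' \<union> F" "g y \<notin> N"
    using spreadE[OF Y, of z t' "F' \<union> F" N] z t' assms(2,3) fin by auto
  have "y \<in> zball S x t"
    using zball_mono[OF t'(2)] y(2) z zball_eq[of z S x t t] by blast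
  moreover have "y t \<notin> F"
    using zball_agree[OF y(2), of t] y(3) z t' by (cases "t' = t") auto
  ultimately show "\<exists>y\<in>?C \<inter> zball S z t'. y t' \<notin> F' \<and> g y \<notin> N"
    using y by blast
qed

lemma spread_cut_nonempty:
  assumes "spread S g s Y" "x \<in> Y" "t \<in> S" "t \<le> s" "finite F"
  shows "{y \<in> Y \<inter> zball S x t. y t \<notin> F} \<noteq> {}"
  using spreadE[OF assms finite.emptyI] by blast

text \<open>For \<open>g = id\<close> the condition on values is automatic: to avoid finitely many points it suffices to avoid
  the children in which they lie.\<close>

lemma spread_idI:
  assumes "Y \<subseteq> B_space S"
    and "\<And>x t F. x \<in> Y \<Longrightarrow> t \<in> S \<Longrightarrow> t \<le> s \<Longrightarrow> finite F \<Longrightarrow> \<exists>y\<in>Y \<inter> zball S x t. y t \<notin> F"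
  shows "spread S id s Y"
  unfolding spread_def
proof (intro conjI ballI allI impI)
  fix x t and F :: "rat set" and N :: "(real \<Rightarrow> rat) set"
  assume *: "x \<in> Y" "t \<in> S" "t \<le> s" and fin: "finite F" "finite N"
  have "finite (F \<union> (\<lambda>z. z t) ` N)" using fin by blast
  then obtain y where "y \<in> Y \<inter> zball S x t" "y t \<notin> F \<union> (\<lambda>z. z t) ` N"
    using assms(2)[OF *] by blast
  then show "\<exists>y\<in>Y \<inter> zball S x t. y t \<notin> F \<and> id y \<notin> N" by (intro bexI[of _ y]) auto
qed (rule assms(1))

lemma B_space_upd:
  assumes "x \<in> B_space S" "t \<in> S"
  shows "x(t := q) \<in> B_space S"
proof -
  have "{s \<in> S. (x(t := q)) s \<noteq> 0} \<subseteq> insert t {s \<in> S. x s \<noteq> 0}" by auto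
  moreover have "finite (insert t {s \<in> S. x s \<noteq> 0})" using assms(1) by (simp add: B_space_def)
  ultimately have "finite {s \<in> S. (x(t := q)) s \<noteq> 0}" by (rule finite_subset)
  then show ?thesis using assms unfolding B_space_def by auto
qed

lemma spread_B_space: "spread S id s (B_space S)"
proof (rule spread_idI)
  fix x t and F :: "rat set"
  assume "x \<in> B_space S" "t \<in> S" "finite F"
  moreover obtain q where "q \<notin> F" using ex_new_if_finite[OF infinite_UNIV_char_0 \<open>finite F\<close>] by blast
  ultimately show "\<exists>y\<in>B_space S \<inter> zball S x t. y t \<notin> F"
    using B_space_upd[of x S t q] by (intro bexI[of _ "x(t := q)"]) (auto intro: zballI)
qed simp

text \<open>Induction on the number of colours. Fix a colour \<open>v\<close>. If its class is not spread, then at some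
  point and scale \<open>t\<close> it meets only finitely many children; the points of \<open>Y\<close> in the other children
  form a nonempty spread set that misses \<open>v\<close>.\<close>

lemma constant_spread_subset:
  fixes f :: "(real \<Rightarrow> rat) \<Rightarrow> 'c"
  assumes "spread S id s Y" "s \<in> S" "Y \<noteq> {}" "finite (f ` Y)"
  shows "\<exists>t Z. t \<in> S \<and> Z \<noteq> {} \<and> Z \<subseteq> Y \<and> spread S id t Z \<and> f constant_on Z"
  using assms
proof (induction "card (f ` Y)" arbitrary: Y s rule: less_induct)
  case less
  obtain v where v: "v \<in> f ` Y" using less.prems by blast
  let ?A = "{y \<in> Y. f y = v}"
  show ?case
  proof (cases "spread S id s ?A")
    case True
    have "f constant_on ?A" by (auto simp: constant_on_def)
    then show ?thesis using True v less.prems(2)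
      by (intro exI[of _ s] exI[of _ ?A]) auto
  next
    case False
    then obtain x t F where x: "x \<in> ?A" and t: "t \<in> S" "t \<le> s" and F: "finite F"
      and none: "\<And>y. y \<in> ?A \<inter> zball S x t \<Longrightarrow> y t \<in> F"
      using spread_idI[of ?A S s] spread_space[OF less.prems(1)] by blast
    let ?C = "{y \<in> Y \<inter> zball S x t. y t \<notin> F}"
    have C: "spread S id t ?C" by (rule spread_cut[OF less.prems(1) t(2) F])
    have "x \<in> Y" using x by simp
    then have ne: "?C \<noteq> {}" by (rule spread_cut_nonempty[OF less.prems(1) _ t F])
    have "f y \<noteq> v" if "y \<in> ?C" for y using none[of y] that by auto
    then have "v \<notin> f ` ?C" by auto
    then have sub: "f ` ?C \<subset> f ` Y" using v by auto
    have fin: "finite (f ` ?C)" using finite_subset[OF psubset_imp_subset[OF sub] less.prems(4)] .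
    show ?thesis
      using less.hyps[OF psubset_card_mono[OF less.prems(4) sub] C t(1) ne fin] by blast
  qed
qed

section \<open>Gluing\<close>

text \<open>Every \<open>u \<in> U\<close> has a largest radius \<open>\<rho> u\<close> for which its ball meets a piece of that radius, and the balls
  \<open>W u\<close> of these radii are pairwise equal or disjoint. The glued set has one piece in every \<open>W u\<close>. Around a
  point of \<open>W u\<close>, scales up to \<open>\<rho> u\<close> are handled by the piece. A larger scale is handled by \<open>U\<close>: each child that meets \<open>U\<close>
  contains an entire \<open>W v\<close>, by maximality of \<open>\<rho> u\<close>, hence a piece, and a piece takes infinitely many
  values under \<open>g\<close>. The last conclusion records where the points of the glued set come from and that
  near each of them it is contained in a single piece.\<close>

lemma glue_spread:
  fixes g :: "(real \<Rightarrow> rat) \<Rightarrow> 'b"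
  assumes max: "\<forall>A \<subseteq> S. A \<noteq> {} \<longrightarrow> (\<exists>m\<in>A. \<forall>a\<in>A. a \<le> m)"
    and U: "spread S id s U" "U \<noteq> {}"
    and cover: "\<And>u. u \<in> U \<Longrightarrow> \<exists>r\<in>S. \<exists>Z. piece r Z \<and> Z \<inter> zball S u r \<noteq> {}"
    and piece: "\<And>r Z. piece r Z \<Longrightarrow> spread S g r Z"
  obtains X where "spread S g s X" "X \<noteq> {}"
    and "\<And>x. x \<in> X \<Longrightarrow> \<exists>u\<in>U. \<exists>r\<in>S. \<exists>Z. piece r Z \<and> x \<in> Z \<inter> zball S u r \<and> X \<inter> zball S x r \<subseteq> Z"
proof -
  have US: "u \<in> B_space S" if "u \<in> U" for u using spread_space[OF U(1)] that by blast
  define Rad where "Rad u = {r \<in> S. \<exists>Z. piece r Z \<and> Z \<inter> zball S u r \<noteq> {}}" for u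
  have "\<exists>m\<in>Rad u. \<forall>r\<in>Rad u. r \<le> m" if "u \<in> U" for u
  proof (rule max[rule_format])
    show "Rad u \<subseteq> S" by (auto simp: Rad_def)
    show "Rad u \<noteq> {}" using cover[OF that] by (auto simp: Rad_def)
  qed
  then obtain \<rho> where \<rho>: "\<And>u. u \<in> U \<Longrightarrow> \<rho> u \<in> Rad u"
    and \<rho>_max: "\<And>u r. u \<in> U \<Longrightarrow> r \<in> Rad u \<Longrightarrow> r \<le> \<rho> u" by metis
  have \<rho>S: "\<rho> u \<in> S" if "u \<in> U" for u using \<rho>[OF that] by (simp add: Rad_def)
  define W where "W u = zball S u (\<rho> u)" for u
  \<comment> \<open>The piece is chosen as a function of the ball, so that all points of a ball agree on it.\<close>
  define K where "K r V = (SOME Z. piece r Z \<and> Z \<inter> V \<noteq> {})" for r and V :: "(real \<Rightarrow> rat) set"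
  have K: "piece (\<rho> u) (K (\<rho> u) (W u)) \<and> K (\<rho> u) (W u) \<inter> W u \<noteq> {}" if "u \<in> U" for u
  proof -
    have "\<exists>Z. piece (\<rho> u) Z \<and> Z \<inter> W u \<noteq> {}" using \<rho>[OF that] by (auto simp: Rad_def W_def)
    then show ?thesis unfolding K_def by (rule someI_ex)
  qed
  define X where "X = (\<Union>u\<in>U. K (\<rho> u) (W u) \<inter> W u)"
  have close: "\<rho> v \<le> \<rho> u" if "u \<in> U" "v \<in> U" "u \<in> zball S v (\<rho> v)" for u v
    using \<rho>[OF that(2)] zball_eq[OF that(3), of "\<rho> v"]
    by (intro \<rho>_max[OF that(1)]) (simp add: Rad_def)
  have disj: "\<rho> u = \<rho> v \<and> W u = W v" if u: "u \<in> U" and v: "v \<in> U"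
    and le: "\<rho> u \<le> \<rho> v" and y: "y \<in> W u \<inter> W v" for u v y
  proof -
    have "zball S u (\<rho> v) = W v"
      using zball_eq[of y S u "\<rho> u" "\<rho> v"] zball_eq[of y S v "\<rho> v" "\<rho> v"] le y by (simp add: W_def)
    then have "u \<in> zball S v (\<rho> v)" using zball_self[OF US[OF u], of "\<rho> v"] by (simp add: W_def)
    then show ?thesis using close[OF u v] le zball_eq[of u S v "\<rho> v" "\<rho> v"] by (simp add: W_def)
  qed
  have "spread S g s X"
    unfolding spread_def
  proof (intro conjI ballI allI impI)
    show "X \<subseteq> B_space S" by (auto simp: X_def W_def zball_def)
  next
    fix x t and F :: "rat set" and N :: "'b set"
    assume x: "x \<in> X" and t: "t \<in> S" "t \<le> s" and F: "finite F" and N: "finite N"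
    from x obtain u where u: "u \<in> U" "x \<in> K (\<rho> u) (W u)" "x \<in> W u" by (auto simp: X_def)
    show "\<exists>y\<in>X \<inter> zball S x t. y t \<notin> F \<and> g y \<notin> N"
    proof (cases "t \<le> \<rho> u")
      case True
      obtain y where y: "y \<in> K (\<rho> u) (W u)" "y \<in> zball S x t" "y t \<notin> F" "g y \<notin> N"
        using spreadE[OF piece[OF conjunct1[OF K[OF u(1)]]] u(2) t(1) True F N] .
      have "y \<in> W u"
        using y(2) zball_mono[OF True] zball_eq[of x S u "\<rho> u" "\<rho> u"] u(3) by (auto simp: W_def)
      then show ?thesis using y u(1) by (auto simp: X_def)
    next
      case False
      then have lt: "\<rho> u < t" by simp
      have xt: "zball S x t = zball S u t" using zball_eq[of x S u "\<rho> u" t] u(3) lt by (simp add: W_def)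
      obtain v where v: "v \<in> U" "v \<in> zball S u t" "v t \<notin> F"
        using spreadE[OF U(1) u(1) t F finite.emptyI] by blast
      have "\<rho> v < t"
      proof (rule ccontr)
        assume "\<not> \<rho> v < t"
        then have "zball S v (\<rho> v) = zball S u (\<rho> v)" by (intro zball_eq[OF v(2)]) simp
        then have "u \<in> zball S v (\<rho> v)" using zball_self[OF US[OF u(1)], of "\<rho> v"] by simp
        then show False using close[OF u(1) v(1)] lt \<open>\<not> \<rho> v < t\<close> by simp
      qed
      obtain z where z: "z \<in> K (\<rho> v) (W v)" "z \<in> W v" using K[OF v(1)] by blast
      obtain y where y: "y \<in> K (\<rho> v) (W v)" "y \<in> zball S z (\<rho> v)" "g y \<notin> N"
        using spreadE[OF piece[OF conjunct1[OF K[OF v(1)]]] z(1) \<rho>S[OF v(1)] order.refl finite.emptyI N]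
        by blast
      have yW: "y \<in> zball S v (\<rho> v)"
        using y(2) z(2) zball_eq[of z S v "\<rho> v" "\<rho> v"] by (simp add: W_def)
      have "y \<in> X" using y(1) yW v(1) by (auto simp: X_def W_def)
      moreover have "y t \<notin> F" using zball_agree[OF yW \<open>\<rho> v < t\<close>] v(3) by simp
      moreover have "y \<in> zball S x t"
        using yW zball_mono[of "\<rho> v" t S v] \<open>\<rho> v < t\<close> zball_eq[OF v(2), of t] xt by auto
      ultimately show ?thesis using y(3) by blast
    qed
  qed
  moreover have "X \<noteq> {}" using U(2) K by (fastforce simp: X_def)
  moreover have "\<exists>u\<in>U. \<exists>r\<in>S. \<exists>Z. piece r Z \<and> x \<in> Z \<inter> zball S u r \<and> X \<inter> zball S x r \<subseteq> Z"
    if "x \<in> X" for x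
  proof -
    from that obtain u where u: "u \<in> U" "x \<in> K (\<rho> u) (W u)" "x \<in> W u" by (auto simp: X_def)
    have "X \<inter> zball S x (\<rho> u) \<subseteq> K (\<rho> u) (W u)"
    proof
      fix y assume y: "y \<in> X \<inter> zball S x (\<rho> u)"
      then have yu: "y \<in> W u" using zball_eq[of x S u "\<rho> u" "\<rho> u"] u(3) by (simp add: W_def)
      from y obtain v where v: "v \<in> U" "y \<in> K (\<rho> v) (W v)" "y \<in> W v" by (auto simp: X_def)
      have "\<rho> u = \<rho> v \<and> W u = W v"
        using disj[OF u(1) v(1)] disj[OF v(1) u(1)] yu v(3) by (metis IntI linear)
      then show "y \<in> K (\<rho> u) (W u)" using v(2) by simp
    qed
    then show ?thesis using u K[OF u(1)] \<rho>S[OF u(1)] unfolding W_def by blast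
  qed
  ultimately show thesis using that by blast
qed

section \<open>Isometric copies in spread sets\<close>

text \<open>A point is determined by the finite graph of its restriction to its support.\<close>

lemma countable_B_space:
  assumes "countable S"
  shows "countable (B_space S)"
proof -
  define code where "code x = (\<lambda>s. (s, x s)) ` {s \<in> S. x s \<noteq> 0}" for x :: "real \<Rightarrow> rat"
  have "inj_on code (B_space S)"
  proof (rule inj_onI)
    fix x y assume xy: "x \<in> B_space S" "y \<in> B_space S" "code x = code y"
    have mem: "(s, q) \<in> code z \<longleftrightarrow> s \<in> S \<and> z s = q \<and> q \<noteq> 0" for s q z
      by (auto simp: code_def)
    show "x = y"
    proof
      fix s
      show "x s = y s"
        using mem[of s "x s" x] mem[of s "x s" y] mem[of s "y s" x] mem[of s "y s" y] xy
        by (cases "s \<in> S"; cases "x s = 0"; cases "y s = 0") (auto simp: B_space_def)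
    qed
  qed
  moreover have "code ` B_space S \<subseteq> {A. finite A \<and> A \<subseteq> S \<times> UNIV}"
    by (auto simp: code_def B_space_def)
  then have "countable (code ` B_space S)"
    using countable_Collect_finite_subset[of "S \<times> (UNIV :: rat set)"] assms
    by (auto intro: countable_subset)
  ultimately show ?thesis using countable_image_inj_on by blast
qed

text \<open>Let \<open>e m\<close> be closest to the new point \<open>c\<close>, at distance \<open>t\<close>. An image for \<open>c\<close> is any point of the \<open>t\<close>-ball
  around \<open>h m\<close> that lies in a child containing no \<open>h i\<close>: the \<open>h i\<close> in this ball then have distance \<open>t\<close> from
  it, and for the others the distance to it equals that to \<open>h m\<close>. Spreadness supplies such a point with a
  new value under \<open>g\<close>.\<close>

lemma extend_isometry:
  assumes S: "S \<subseteq> {0<..}"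
    and Y: "spread S g s Y" and top: "\<And>t. t \<in> S \<Longrightarrow> t \<le> s"
    and I: "finite I" "I \<noteq> {}"
    and e: "e ` I \<subseteq> B_space S" "c \<in> B_space S" "c \<notin> e ` I"
    and h: "h ` I \<subseteq> Y"
    and iso: "\<And>i j. i \<in> I \<Longrightarrow> j \<in> I \<Longrightarrow> B_dist S (h i) (h j) = B_dist S (e i) (e j)"
  shows "\<exists>y\<in>Y. \<forall>i\<in>I. B_dist S (h i) y = B_dist S (e i) c \<and> g (h i) \<noteq> g y"
proof -
  obtain m where m: "m \<in> I" and min: "\<And>i. i \<in> I \<Longrightarrow> B_dist S (e m) c \<le> B_dist S (e i) c"
    using ex_min_if_finite[of "(\<lambda>i. B_dist S (e i) c) ` I"] I by (auto simp: not_less)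
  define t where "t = B_dist S (e m) c"
  have eB: "e i \<in> B_space S" and hB: "h i \<in> B_space S" if "i \<in> I" for i
    using that e h spread_space[OF Y] by auto
  have tS: "t \<in> S"
    unfolding t_def using B_dist_in[OF eB[OF m] e(2)] e(3) m by blast
  then have t0: "0 \<le> t" using S by force
  obtain y where y: "y \<in> Y" "y \<in> zball S (h m) t"
    "y t \<notin> (\<lambda>i. h i t) ` I" "g y \<notin> (\<lambda>i. g (h i)) ` I"
  proof (rule spreadE[OF Y _ tS top[OF tS]])
    show "h m \<in> Y" using h m by blast
    show "finite ((\<lambda>i. h i t) ` I)" "finite ((\<lambda>i. g (h i)) ` I)" using I by auto
  qed
  have yB: "y \<in> B_space S" using y(2) by (rule zball_space)
  have "B_dist S (h i) y = B_dist S (e i) c" if i: "i \<in> I" for i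
  proof (cases "B_dist S (e i) (e m) \<le> t")
    case True
    have "B_dist S (e i) c = t"
      using B_dist_ultrametric[OF S eB[OF i] eB[OF m] e(2)] min[OF i] True by (simp add: t_def)
    moreover have "B_dist S (h i) y = t"
    proof (rule B_dist_eqI[OF S hB[OF i] _ tS])
      have "h m \<in> zball S (h i) t"
        using zball_iff_dist[OF hB[OF i] hB[OF m] t0] True iso[OF i m] by simp
      then show "y \<in> zball S (h i) t" using y(2) zball_eq by blast
      show "h i t \<noteq> y t" using y(3) i by (metis image_eqI)
    qed
    ultimately show ?thesis by simp
  next
    case False
    have "B_dist S (e i) c = B_dist S (e i) (e m)"
      using B_dist_isosceles[OF S eB[OF i] eB[OF m] e(2)] False by (simp add: t_def)
    moreover have "B_dist S (h m) y \<le> t" using zball_iff_dist[OF hB[OF m] yB t0] y(2) by simp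
    then have "B_dist S (h i) y = B_dist S (h i) (h m)"
      using B_dist_isosceles[OF S hB[OF i] hB[OF m] yB] False iso[OF i m] by simp
    ultimately show ?thesis using iso[OF i m] by simp
  qed
  moreover have "g (h i) \<noteq> g y" if "i \<in> I" for i using y(4) that by (metis image_eqI)
  ultimately show ?thesis using y(1) by blast
qed

lemma isometric_copy_in_spread:
  assumes S: "countable S" "S \<subseteq> {0<..}"
    and Y: "spread S g s Y" "Y \<noteq> {}" and top: "\<And>t. t \<in> S \<Longrightarrow> t \<le> s"
  obtains X where "isometric_copy_within X (B_space S) (B_dist S) (B_space S) (B_dist S)"
    "X \<subseteq> Y" "inj_on g X"
proof -
  have "(\<lambda>_. 0) \<in> B_space S" by (simp add: B_space_def)
  then have ne: "B_space S \<noteq> {}" by blast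
  define e where "e = from_nat_into (B_space S)"
  have eB: "e n \<in> B_space S" for n unfolding e_def using from_nat_into[OF ne] .
  have er: "range e = B_space S"
    unfolding e_def using range_from_nat_into[OF ne countable_B_space[OF S(1)]] .
  define P where "P h n y \<longleftrightarrow> y \<in> Y \<and> (\<forall>m<n. B_dist S (h m) y = B_dist S (e m) (e n) \<and>
      (e m \<noteq> e n \<longrightarrow> g (h m) \<noteq> g y))" for h :: "nat \<Rightarrow> real \<Rightarrow> rat" and n y
  have iso: "B_dist S (h i) (h j) = B_dist S (e i) (e j)"
    if "P h i (h i)" "P h j (h j)" for h i j
    using that B_dist_commute[of S "h i" "h j"] B_dist_commute[of S "e i" "e j"]
    by (cases i j rule: linorder_cases) (auto simp: P_def B_dist_def[of S "_ j" "_ j"])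
  \<comment> \<open>The enumeration \<open>e\<close> may repeat points; a repeated point receives its earlier image.\<close>
  have "\<exists>h. \<forall>n. P h n (h n)"
  proof (rule dependent_wellorder_choice)
    show "P h n y = P h' n y" if "\<And>m. m < n \<Longrightarrow> h m = h' m" for y h h' n
      using that by (auto simp: P_def)
  next
    fix n h assume hyp: "\<And>m. m < n \<Longrightarrow> P h m (h m)"
    have hY: "h m \<in> Y" if "m < n" for m using hyp[OF that] by (simp add: P_def)
    have hg: "g (h i) \<noteq> g (h j)" if "i < n" "j < n" "e i \<noteq> e j" for i j
      using hyp[OF that(1)] hyp[OF that(2)] that(3)
      by (cases i j rule: linorder_cases) (auto simp: P_def)
    show "\<exists>y. P h n y"
    proof (cases "e n \<in> e ` {..<n}")
      case True
      then obtain m where m: "m < n" "e n = e m" by auto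
      have "P h n (h m)"
        using m hY[OF m(1)] iso[OF hyp hyp[OF m(1)]] hg[OF _ m(1)] by (simp add: P_def)
      then show ?thesis by blast
    next
      case new: False
      show ?thesis
      proof (cases "n = 0")
        case True
        then show ?thesis using Y(2) by (auto simp: P_def)
      next
        case False
        have "\<exists>y\<in>Y. \<forall>i\<in>{..<n}. B_dist S (h i) y = B_dist S (e i) (e n) \<and> g (h i) \<noteq> g y"
        proof (rule extend_isometry[OF S(2) Y(1) top])
          show "{..<n} \<noteq> {}" using False by auto
          show "e ` {..<n} \<subseteq> B_space S" using eB by blast
          show "h ` {..<n} \<subseteq> Y" using hY by blast
          show "B_dist S (h i) (h j) = B_dist S (e i) (e j)" if "i \<in> {..<n}" "j \<in> {..<n}" for i j
            using iso hyp that by simp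
        qed (use eB new in auto)
        then show ?thesis by (auto simp: P_def)
      qed
    qed
  qed
  then obtain h where h: "\<And>n. P h n (h n)" by blast
  have hY: "h n \<in> Y" for n using h[of n] by (simp add: P_def)
  have hB: "h n \<in> B_space S" for n using hY spread_space[OF Y(1)] by blast
  have hg: "g (h i) \<noteq> g (h j)" if "e i \<noteq> e j" for i j
    using h[of i] h[of j] that by (cases i j rule: linorder_cases) (auto simp: P_def)
  define k where "k x = (SOME n. e n = x)" for x
  have ek: "e (k x) = x" if "x \<in> B_space S" for x
    unfolding k_def using that er by (metis (mono_tags, lifting) imageE someI_ex)
  define \<phi> where "\<phi> x = h (k x)" for x
  have ginj: "g (\<phi> x) \<noteq> g (\<phi> y)" if "x \<in> B_space S" "y \<in> B_space S" "x \<noteq> y" for x y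
    using hg[of "k x" "k y"] ek that by (simp add: \<phi>_def)
  have "bij_betw \<phi> (B_space S) (\<phi> ` B_space S)"
    using ginj by (intro inj_on_imp_bij_betw inj_onI) metis
  moreover have "B_dist S (\<phi> x) (\<phi> y) = B_dist S x y"
    if "x \<in> B_space S" "y \<in> B_space S" for x y
    unfolding \<phi>_def using iso[OF h h, of "k x" "k y"] ek that by simp
  ultimately have "isometric_copy_within (\<phi> ` B_space S) (B_space S) (B_dist S) (B_space S) (B_dist S)"
    unfolding isometric_copy_within_def using hB by (auto simp: \<phi>_def)
  moreover have "\<phi> ` B_space S \<subseteq> Y" using hY by (auto simp: \<phi>_def)
  moreover have "inj_on g (\<phi> ` B_space S)" using ginj by (intro inj_onI) blast
  ultimately show thesis using that by blast
qed

section \<open>The dichotomy\<close>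

text \<open>The points whose balls, at every scale, are too poor in values of \<open>f\<close> to meet a set that is
  spread for \<open>f\<close> up to that scale.\<close>

definition spread_free ::
  "real set \<Rightarrow> ((real \<Rightarrow> rat) \<Rightarrow> 'b) \<Rightarrow> (real \<Rightarrow> rat) set" where
  "spread_free S f = {x \<in> B_space S. \<forall>r\<in>S. \<forall>Z. spread S f r Z \<longrightarrow> Z \<inter> zball S x r = {}}"

text \<open>If all children of the \<open>s\<close>-ball except those in \<open>F\<close> missed \<open>spread_free S f\<close>, each of their points
  would have a ball meeting a set spread for \<open>f\<close>. These balls have radius below \<open>s\<close>, as larger ones would
  be balls around \<open>x\<close>. Gluing the sets would then yield one that is spread for \<open>f\<close> up to \<open>s\<close> and meets
  the \<open>s\<close>-ball of \<open>x\<close>.\<close>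

lemma spread_free_meets_children:
  assumes max: "\<forall>A \<subseteq> S. A \<noteq> {} \<longrightarrow> (\<exists>m\<in>A. \<forall>a\<in>A. a \<le> m)"
    and x: "x \<in> B_space S" and s: "s \<in> S" and F: "finite F"
    and none: "\<And>r Z. r \<in> S \<Longrightarrow> s \<le> r \<Longrightarrow> spread S f r Z \<Longrightarrow> Z \<inter> zball S x r = {}"
  shows "\<exists>y\<in>spread_free S f \<inter> zball S x s. y s \<notin> F"
proof (rule ccontr)
  assume miss: "\<not> ?thesis"
  define U where "U = {y \<in> B_space S \<inter> zball S x s. y s \<notin> F}"
  have U: "spread S id s U"
    unfolding U_def by (rule spread_cut[OF spread_B_space order.refl F])
  have "U \<noteq> {}"
    unfolding U_def by (rule spread_cut_nonempty[OF spread_B_space x s order.refl F])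
  moreover have "\<exists>r\<in>S. \<exists>Z. spread S f r Z \<and> Z \<inter> zball S u r \<noteq> {}" if "u \<in> U" for u
  proof -
    have "u \<notin> spread_free S f" using miss that unfolding U_def by blast
    then show ?thesis using that unfolding spread_free_def U_def by blast
  qed
  ultimately obtain X where X: "spread S f s X" "X \<noteq> {}"
    and pieces: "\<And>y. y \<in> X \<Longrightarrow> \<exists>u\<in>U. \<exists>r\<in>S. \<exists>Z. spread S f r Z \<and> y \<in> Z \<inter> zball S u r \<and>
      X \<inter> zball S y r \<subseteq> Z"
    using glue_spread[OF max U, where piece = "spread S f" and g = f] by blast
  obtain y where y: "y \<in> X" using X(2) by blast
  obtain u r Z where u: "u \<in> U" "r \<in> S" "spread S f r Z" "y \<in> Z" "y \<in> zball S u r"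
    using pieces[OF y] by blast
  have ux: "u \<in> zball S x s" using u(1) by (simp add: U_def)
  have "r < s"
  proof (rule ccontr)
    assume "\<not> r < s"
    then show False using none[OF u(2) _ u(3)] zball_eq[OF ux, of r] u(4,5) by auto
  qed
  then have "y \<in> zball S x s"
    using u(5) zball_mono[of r s S u] zball_eq[OF ux, of s] by auto
  then show False using none[OF s order.refl X(1)] y by blast
qed

lemma spread_free_is_spread:
  assumes max: "\<forall>A \<subseteq> S. A \<noteq> {} \<longrightarrow> (\<exists>m\<in>A. \<forall>a\<in>A. a \<le> m)"
  shows "spread S id s (spread_free S f)"
proof (rule spread_idI)
  show "spread_free S f \<subseteq> B_space S" by (auto simp: spread_free_def)
  show "\<exists>y\<in>spread_free S f \<inter> zball S x t. y t \<notin> F"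
    if "x \<in> spread_free S f" "t \<in> S" "finite F" for x t F
    using that by (intro spread_free_meets_children[OF max]) (auto simp: spread_free_def)
qed

text \<open>Since \<open>Y\<close> is not spread for \<open>f\<close>, near some point it is covered by finitely many children together
  with finitely many colours; outside these children only those colours occur.\<close>

lemma spread_free_constant_subset:
  assumes Y: "spread S id s Y" "Y \<noteq> {}" "Y \<subseteq> spread_free S f" and s: "s \<in> S"
  shows "\<exists>t Z. t \<in> S \<and> Z \<noteq> {} \<and> Z \<subseteq> Y \<and> spread S id t Z \<and> f constant_on Z"
proof -
  have "\<not> spread S f s Y"
  proof
    assume "spread S f s Y"
    moreover obtain x where "x \<in> Y" using Y(2) by blast
    ultimately show False
      using Y(3) s zball_self[of x S s] by (auto simp: spread_free_def)
  qed
  then obtain x t F N where x: "x \<in> Y" "t \<in> S" "t \<le> s" and fin: "finite F" "finite N"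
    and cov: "\<And>y. y \<in> Y \<inter> zball S x t \<Longrightarrow> y t \<notin> F \<Longrightarrow> f y \<in> N"
    using spread_space[OF Y(1)] unfolding spread_def by blast
  let ?C = "{y \<in> Y \<inter> zball S x t. y t \<notin> F}"
  have "spread S id t ?C" by (rule spread_cut[OF Y(1) x(3) fin(1)])
  moreover have "?C \<noteq> {}" by (rule spread_cut_nonempty[OF Y(1) x fin(1)])
  moreover have "finite (f ` ?C)" using cov by (intro finite_subset[OF _ fin(2)]) auto
  ultimately obtain r Z where
    "r \<in> S" "Z \<noteq> {}" "Z \<subseteq> ?C" "spread S id r Z" "f constant_on Z"
    using constant_spread_subset[OF _ x(2), of ?C f] by auto
  moreover from this have "Z \<subseteq> Y" by auto
  ultimately show ?thesis by (intro exI[of _ r] exI[of _ Z] conjI)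
qed

lemma continuous_map_locally_constant:
  assumes "Metric_space M d" "X \<subseteq> M"
    and "\<And>x. x \<in> X \<Longrightarrow> \<exists>r>0. \<forall>y\<in>X. d x y < r \<longrightarrow> f y = f x"
  shows "continuous_map (subtopology (Metric_space.mtopology M d) X) (discrete_topology UNIV) f"
proof -
  interpret Metric_space M d by fact
  obtain r where r: "\<And>x. x \<in> X \<Longrightarrow> r x > 0 \<and> (\<forall>y\<in>X. d x y < r x \<longrightarrow> f y = f x)"
    using assms(3) by metis
  have "openin (subtopology mtopology X) {x \<in> X. f x \<in> V}" for V
  proof -
    define P where "P = {x \<in> X. f x \<in> V}"
    have PX: "P \<subseteq> X" by (auto simp: P_def)
    have "P = (\<Union>x\<in>P. mball x (r x)) \<inter> X"
    proof (intro equalityI subsetI)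
      fix y assume y: "y \<in> P"
      then have "y \<in> M" "0 < r y" using r[of y] assms(2) PX by blast+
      then have "y \<in> mball y (r y)" by simp
      then show "y \<in> (\<Union>x\<in>P. mball x (r x)) \<inter> X" using y PX by blast
    next
      fix y assume "y \<in> (\<Union>x\<in>P. mball x (r x)) \<inter> X"
      then obtain x where x: "x \<in> P" "y \<in> mball x (r x)" "y \<in> X" by blast
      then have "f y = f x" using r[of x] PX by auto
      then show "y \<in> P" using x by (simp add: P_def)
    qed
    moreover have "openin mtopology (\<Union>x\<in>P. mball x (r x))"
      by (intro openin_Union ballI) auto
    ultimately have "openin (subtopology mtopology X) P"
      unfolding openin_subtopology by (intro exI conjI)
    then show ?thesis by (simp add: P_def)
  qed
  then show ?thesis using assms(2) by (simp add: continuous_map_def Int_absorb1)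
qed

theorem theorem61:
  fixes S :: "real set" and f :: "(real \<Rightarrow> rat) \<Rightarrow> nat"
  assumes "infinite S" and "countable S" and "S \<subseteq> {0<..}"
    and "\<forall>A \<subseteq> S. A \<noteq> {} \<longrightarrow> (\<exists>m\<in>A. \<forall>a\<in>A. a \<le> m)"
  shows "\<exists>X. isometric_copy_within X (B_space S) (B_dist S) (B_space S) (B_dist S) \<and>
    (continuous_map (subtopology (Metric_space.mtopology (B_space S) (B_dist S)) X)
       (discrete_topology UNIV) f \<or>
     inj_on f X)"
proof -
  obtain s where s: "s \<in> S" and top: "\<And>t. t \<in> S \<Longrightarrow> t \<le> s"
    using assms(4) \<open>infinite S\<close> by (metis finite.emptyI order.refl)
  show ?thesis
  proof (cases "\<exists>Z. spread S f s Z \<and> Z \<noteq> {}")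
    case True
    then show ?thesis using isometric_copy_in_spread[OF assms(2,3) _ _ top, of f] by metis
  next
    case False
    let ?R = "spread_free S f"
    have R: "spread S id s ?R" by (rule spread_free_is_spread[OF assms(4)])
    have "\<exists>y\<in>?R \<inter> zball S (\<lambda>_. 0) s. y s \<notin> {}"
    proof (rule spread_free_meets_children[OF assms(4) _ s])
      show "Z \<inter> zball S (\<lambda>_. 0) r = {}" if "r \<in> S" "s \<le> r" "spread S f r Z" for r Z
        using False that top[OF that(1)] by (metis Int_empty_left order.antisym)
    qed (simp_all add: B_space_def)
    then have "?R \<noteq> {}" by blast
    \<comment> \<open>Monochromatic pieces need not cover \<open>spread_free S f\<close>, but the points that they do reach are dense
      in it, and this suffices for \<open>U\<close> to be spread.\<close>
    define piece where "piece r Z \<longleftrightarrow> Z \<subseteq> ?R \<and> spread S id r Z \<and> f constant_on Z" for r Z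
    define U where "U = {u \<in> ?R. \<exists>r\<in>S. \<exists>Z. piece r Z \<and> Z \<inter> zball S u r \<noteq> {}}"
    have dense: "U \<inter> Y \<noteq> {}" if Y: "spread S id t Y" "Y \<noteq> {}" "Y \<subseteq> ?R" "t \<in> S" for t Y
    proof -
      obtain r Z where Z: "r \<in> S" "Z \<noteq> {}" "Z \<subseteq> Y" "spread S id r Z" "f constant_on Z"
        using spread_free_constant_subset[OF Y] by blast
      obtain z where z: "z \<in> Z" using Z(2) by blast
      have "z \<in> zball S z r" using z spread_space[OF Z(4)] by (blast intro: zball_self)
      then show ?thesis using z Z Y(3) unfolding U_def piece_def by blast
    qed
    have "U \<noteq> {}" using dense[OF R \<open>?R \<noteq> {}\<close> order.refl s] by blast
    have U: "spread S id s U"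
    proof (rule spread_idI)
      show "U \<subseteq> B_space S" using spread_space[OF R] by (auto simp: U_def)
      fix x t and F :: "rat set"
      assume x: "x \<in> U" and t: "t \<in> S" "t \<le> s" and F: "finite F"
      let ?C = "{y \<in> ?R \<inter> zball S x t. y t \<notin> F}"
      have "spread S id t ?C" by (rule spread_cut[OF R t(2) F])
      moreover have "x \<in> ?R" using x by (simp add: U_def)
      then have "?C \<noteq> {}" by (rule spread_cut_nonempty[OF R _ t F])
      ultimately have "U \<inter> ?C \<noteq> {}" using t(1) by (intro dense) auto
      then show "\<exists>y\<in>U \<inter> zball S x t. y t \<notin> F" by blast
    qed
    obtain Y where Y: "spread S id s Y" "Y \<noteq> {}"
      and loc: "\<And>x. x \<in> Y \<Longrightarrow> \<exists>u\<in>U. \<exists>r\<in>S. \<exists>Z. piece r Z \<and> x \<in> Z \<inter> zball S u r \<and>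
        Y \<inter> zball S x r \<subseteq> Z"
      using glue_spread[OF assms(4) U \<open>U \<noteq> {}\<close>, where piece = piece and g = id]
      by (auto simp: U_def piece_def)
    obtain X where X: "isometric_copy_within X (B_space S) (B_dist S) (B_space S) (B_dist S)" "X \<subseteq> Y"
      using isometric_copy_in_spread[OF assms(2,3) Y top] by blast
    have YB: "Y \<subseteq> B_space S" using spread_space[OF Y(1)] .
    have "continuous_map (subtopology (Metric_space.mtopology (B_space S) (B_dist S)) X)
       (discrete_topology UNIV) f"
    proof (rule continuous_map_locally_constant[OF Metric_space_B[OF assms(3)]])
      show "X \<subseteq> B_space S" using X(2) YB by blast
      fix x assume x: "x \<in> X"
      then obtain r Z where r: "r \<in> S" "piece r Z" "x \<in> Z" "Y \<inter> zball S x r \<subseteq> Z"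
        using loc X(2) by blast
      have r0: "0 < r" using r(1) assms(3) by force
      have "f y = f x" if "y \<in> X" "B_dist S x y < r" for y
      proof -
        have "y \<in> zball S x r"
          using zball_iff_dist[of x S y r] that x X(2) YB r0 by auto
        then have "y \<in> Z" using r(4) that(1) X(2) by blast
        then show ?thesis using r(2,3) by (auto simp: piece_def constant_on_def)
      qed
      then show "\<exists>r>0. \<forall>y\<in>X. B_dist S x y < r \<longrightarrow> f y = f x" using r0 by blast
    qed
    then show ?thesis using X(1) by blast
  qed
qed

end
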